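(* Let $K\ge2$ and suppose the loss vectors $(\ell_t^1,\dots,\ell_t^K)\in[0,1]^K$, $t=1,2,\dots$, are drawn i.i.d. across rounds, with means $\mathbb E[\ell_t^a]=\mu_a$, an optimal arm $a^\star$ with $\mu_{a^\star}\le\mu_a$ for all $a$, gaps $\Delta_a=\mu_a-\mu_{a^\star}$, and effective loss range $\varepsilon$. Then for every $T\ge1$ the expected regret of SODA satisfies \[ \mathcal{R}_T\le\sum_{a:\Delta_a>0}\left[\left(\frac{16K^3}{\ln K}+16K^2\right)\frac{\varepsilon^2}{\Delta_a}+4K^2+\frac{\Delta_a}{K}\right]. \]
   Context: Setting: $K$ arms, $[K]=\{1,\dots,K\}$. In each round $t$ the learner picks a primary arm $A_t$, suffers and observes $\ell_t^{A_t}$, and picks a secondary arm $B_t$ (after $A_t$) whose loss $\ell_t^{B_t}$ is observed but not suffered. The effective loss range is the smallest $\varepsilon$ such that $|\ell_t^a-\ell_t^{a'}|\le\varepsilon$ almost surely for all $t$ and $a,a'\in[K]$. The expected regret is $\mathcal{R}_T=\mathbb{E}[\sum_{t=1}^T\ell_t^{A_t}]-\min_{a}\mathbb{E}[\sum_{t=1}^T\ell_t^a]$, which in this stochastic setting equals $\sum_{a:\Delta_a>0}\Delta_a\mathbb E[\sum_{t=1}^T\mathbb 1(A_t=a)]$. SODA: for each round $t$, draw $A_t\sim \mathbf p_t$, then draw $B_t$ uniformly from $[K]\setminus\{A_t\}$, observe $\ell_t^{A_t},\ell_t^{B_t}$, and set $\widetilde{\Delta\ell}_t^a=(K-1)\mathbb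 1(B_t=a)(\ell_t^{B_t}-\ell_t^{A_t})$ for all $a$. Let $D_t(a)=\sum_{s=1}^t\widetilde{\Delta\ell}_s^a$, $S_t(a)=\sum_{s=1}^t(\widetilde{\Delta\ell}_s^a)^2$, $D_0=S_0=0$, $\eta_t=\min\{\sqrt{\ln K/(\max_a S_{t-1}(a)+(K-1)^2)},\,1/(2(K-1))\}$ and $p_t^a=\exp(-\eta_tD_{t-1}(a)-\eta_t^2S_{t-1}(a))/\sum_{b}\exp(-\eta_tD_{t-1}(b)-\eta_t^2S_{t-1}(b))$. *)

theory Defs
  imports "HOL-Probability.Probability"
begin

text \<open>Arms are indexed by 0..K-1. A loss vector is a function nat => real restricted
  to {..<K}. The loss distribution L is a probability measure on loss vectors;
  the rounds draw i.i.d. samples from L.\<close>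

type_synonym soda_state = "(nat \<Rightarrow> real) \<times> (nat \<Rightarrow> real)"

definition soda_eta :: "nat \<Rightarrow> soda_state \<Rightarrow> real" where
  "soda_eta K st = min (sqrt (ln (real K) / (Max (snd st ` {..<K}) + (real K - 1)^2)))
                       (1 / (2 * (real K - 1)))"

definition soda_p :: "nat \<Rightarrow> soda_state \<Rightarrow> nat \<Rightarrow> real" where
  "soda_p K st a =
     exp (- soda_eta K st * fst st a - (soda_eta K st)^2 * snd st a) /
     (\<Sum>b<K. exp (- soda_eta K st * fst st b - (soda_eta K st)^2 * snd st b))"

text \<open>Loss-difference estimate when primary arm i, secondary arm j, loss vector l.\<close>
definition soda_est :: "nat \<Rightarrow> nat \<Rightarrow> nat \<Rightarrow> (nat \<Rightarrow> real) \<Rightarrow> nat \<Rightarrow> real" where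
  "soda_est K i j l a = (real K - 1) * (if j = a then 1 else 0) * (l j - l i)"

definition soda_upd :: "nat \<Rightarrow> soda_state \<Rightarrow> nat \<Rightarrow> nat \<Rightarrow> (nat \<Rightarrow> real) \<Rightarrow> soda_state" where
  "soda_upd K st i j l =
     ((\<lambda>a. fst st a + soda_est K i j l a), (\<lambda>a. snd st a + (soda_est K i j l a)^2))"

text \<open>Expected cumulative suffered loss of SODA over the next T rounds, started in
  state st, when loss vectors are drawn i.i.d. from L: in each round A ~ p,
  B uniform on [K] - {A}, l ~ L independently of the past.\<close>
fun soda_loss :: "nat \<Rightarrow> (nat \<Rightarrow> real) measure \<Rightarrow> nat \<Rightarrow> soda_state \<Rightarrow> real" where
  "soda_loss K L 0 st = 0"
| "soda_loss K L (Suc T) st =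
     (\<Sum>i<K. soda_p K st i *
        (\<Sum>j\<in>{..<K} - {i}. (1 / (real K - 1)) *
           (\<integral>l. l i + soda_loss K L T (soda_upd K st i j l) \<partial>L)))"

definition arm_mean :: "(nat \<Rightarrow> real) measure \<Rightarrow> nat \<Rightarrow> real" where
  "arm_mean L a = (\<integral>l. l a \<partial>L)"

definition arm_gap :: "nat \<Rightarrow> (nat \<Rightarrow> real) measure \<Rightarrow> nat \<Rightarrow> real" where
  "arm_gap K L a = arm_mean L a - (MIN b\<in>{..<K}. arm_mean L b)"

definition eff_range :: "nat \<Rightarrow> (nat \<Rightarrow> real) measure \<Rightarrow> real" where
  "eff_range K L = Inf {e. AE l in L. \<forall>a<K. \<forall>b<K. \<bar>l a - l b\<bar> \<le> e}"

definition soda_regret :: "nat \<Rightarrow> (nat \<Rightarrow> real) measure \<Rightarrow> nat \<Rightarrow> real" where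
  "soda_regret K L T = soda_loss K L T (\<lambda>_. 0, \<lambda>_. 0) - (MIN a\<in>{..<K}. real T * arm_mean L a)"

end

theory Submission
  imports Defs
begin

text \<open>Fix a suboptimal arm \<open>a\<close> with gap \<open>\<Delta>\<close> and let \<open>X\<close> be the estimated
  cumulative loss of \<open>a\<close> minus that of the optimal arm. After \<open>m\<close> rounds, \<open>X\<close> has mean
  \<open>m \<Delta>\<close> and increments bounded by \<open>R = (K - 1) \<epsilon>\<close>. Since the learning rate
  satisfies \<open>\<eta>\<^sup>2 S \<le> ln K\<close>, the second order correction costs at most a factor
  \<open>K\<close>, so \<open>a\<close> is played with probability at most \<open>K exp (- \<eta> X)\<close>. Where
  \<open>X \<ge> m \<Delta> / 2\<close>, this decays like \<open>exp (- c \<Delta> sqrt m / R)\<close>, or like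
  \<open>exp (- m \<Delta> / (4 (K - 1)))\<close> while the learning rate is at its cap; elsewhere the Chernoff
  bound \<open>1 \<le> exp (\<lambda> (m \<Delta> / 2 - X))\<close> is used. Summing the three
  resulting series over \<open>m \<ge> 1\<close> gives the three terms of the bound that do not come from
  the first round, in which every arm has probability \<open>1 / K\<close>. The Chernoff bounds are
  propagated through the recursion for the expected loss by backward induction over states with
  \<open>S \<le> m R\<^sup>2\<close>.\<close>

section \<open>Elementary inequalities\<close>

text \<open>For negative \<open>x\<close>, with \<open>y = - x\<close>, this follows from
  \<open>1 + y \<le> exp y\<close> and
  \<open>(1 - y + y\<^sup>2) * (1 + y) = 1 + y ^ 3\<close>.\<close>

lemma exp_le_quadratic:
  fixes x :: real
  assumes "\<bar>x\<bar> \<le> 1"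
  shows "exp x \<le> 1 + x + x\<^sup>2"
proof (cases "x \<ge> 0")
  case True
  then show ?thesis using exp_bound[of x] assms by auto
next
  case False
  define y where "y = - x"
  have y: "0 < y" using False by (simp add: y_def)
  have "exp x = 1 / exp y" by (simp add: y_def exp_minus field_simps)
  also have "\<dots> \<le> 1 / (1 + y)"
    using y exp_ge_add_one_self[of y] by (intro divide_left_mono) auto
  also have "\<dots> \<le> 1 - y + y\<^sup>2"
  proof -
    have "1 \<le> 1 + y ^ 3" using y by simp
    also have "\<dots> = (1 - y + y\<^sup>2) * (1 + y)" by algebra
    finally show ?thesis using y by (simp add: divide_le_eq)
  qed
  finally show ?thesis by (simp add: y_def)
qed

text \<open>By \<open>1 + c \<le> exp c\<close>, each summand is at most a difference of consecutive
  values of \<open>exp (- c * real k) / c\<close>, so the sum telescopes.\<close>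

lemma sum_exp_le:
  fixes c :: real
  assumes "c > 0"
  shows "(\<Sum>k<n. exp (- c * real (Suc k))) \<le> 1 / c"
proof -
  have "(\<Sum>k<n. exp (- c * real (Suc k))) \<le> (1 - exp (- c * real n)) / c"
  proof (induction n)
    case (Suc n)
    have "(1 + c) * exp (- c * real (Suc n)) \<le> exp c * exp (- c * real (Suc n))"
      by (intro mult_right_mono exp_ge_add_one_self) auto
    also have "\<dots> = exp (- c * real n)"
      by (simp add: exp_add[symmetric] algebra_simps)
    finally have "c * exp (- c * real (Suc n)) \<le> exp (- c * real n) - exp (- c * real (Suc n))"
      by (simp add: algebra_simps)
    then have "exp (- c * real (Suc n)) \<le> (exp (- c * real n) - exp (- c * real (Suc n))) / c"
      using assms by (simp add: le_divide_eq mult.commute)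
    with Suc show ?case by (simp add: diff_divide_distrib)
  qed simp
  also have "\<dots> \<le> 1 / c"
    using assms by (intro divide_right_mono) auto
  finally show ?thesis .
qed

lemma sum_exp_sqrt_le:
  fixes c :: real
  assumes c: "c > 0"
  shows "(\<Sum>k<n. exp (- c * sqrt (real (Suc k)))) \<le> 2 / c\<^sup>2"
proof -
  \<comment> \<open>\<open>G\<close> is the tail integral of \<open>exp (- c * sqrt x)\<close>.\<close>
  define G where "G k = 2 * (c * sqrt (real k) + 1) * exp (- c * sqrt (real k)) / c\<^sup>2" for k
  have step: "exp (- c * sqrt (real (Suc k))) \<le> G k - G (Suc k)" for k
  proof -
    define x y where "x = c * sqrt (real k)" and "y = c * sqrt (real (Suc k))"
    have x: "0 \<le> x" and xy: "0 \<le> y - x"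
      using c by (auto simp: x_def y_def)
    have c2: "y\<^sup>2 - x\<^sup>2 = c\<^sup>2"
      by (simp add: x_def y_def power_mult_distrib algebra_simps)
    \<comment> \<open>Up to the factor \<open>c\<^sup>2 * exp y\<close>, \<open>step\<close> says
      \<open>2 * (y + 1) + c\<^sup>2 \<le> 2 * (x + 1) * exp (y - x)\<close>. Since
      \<open>c\<^sup>2 = y\<^sup>2 - x\<^sup>2\<close>, the quadratic Taylor bound of the
      exponential is enough.\<close>
    have "2 * (y + 1) + (y\<^sup>2 - x\<^sup>2)
        = 2 * (x + 1) * (1 + (y - x) + (y - x)\<^sup>2 / 2) - (y - x)\<^sup>2 * x"
      by (simp add: field_simps power2_eq_square)
    also have "\<dots> \<le> 2 * (x + 1) * (1 + (y - x) + (y - x)\<^sup>2 / 2)"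
      using x by simp
    also have "\<dots> \<le> 2 * (x + 1) * exp (y - x)"
      using x xy by (intro mult_left_mono exp_lower_Taylor_quadratic) auto
    finally have "(2 * (y + 1) + c\<^sup>2) * exp (- y) \<le> (2 * (x + 1) * exp (y - x)) * exp (- y)"
      unfolding c2 by (intro mult_right_mono) auto
    also have "\<dots> = 2 * (x + 1) * exp (- x)"
      by (simp add: mult.assoc exp_add[symmetric])
    finally have "c\<^sup>2 * exp (- y) \<le> 2 * (x + 1) * exp (- x) - 2 * (y + 1) * exp (- y)"
      by (simp add: algebra_simps)
    then have "exp (- y) \<le> (2 * (x + 1) * exp (- x) - 2 * (y + 1) * exp (- y)) / c\<^sup>2"
      using c by (simp add: le_divide_eq mult.commute)
    then show ?thesis
      by (simp add: G_def x_def y_def diff_divide_distrib)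
  qed
  have "(\<Sum>k<n. exp (- c * sqrt (real (Suc k)))) \<le> (\<Sum>k<n. G k - G (Suc k))"
    by (intro sum_mono step)
  also have "\<dots> = G 0 - G n"
    using sum_lessThan_telescope'[of G n] by simp
  also have "\<dots> \<le> G 0"
    using c by (simp add: G_def)
  finally show ?thesis by (simp add: G_def)
qed

section \<open>One round of SODA\<close>

locale soda = prob_space L for L :: "(nat \<Rightarrow> real) measure" +
  fixes K s :: nat
  assumes K2: "K \<ge> 2"
    and sets_L: "sets L = sets (\<Pi>\<^sub>M a\<in>{..<K}. borel)"
    and loss01: "AE l in L. \<forall>a<K. 0 \<le> l a \<and> l a \<le> 1"
    and s_less: "s < K"
    and s_best: "\<And>a. a < K \<Longrightarrow> arm_mean L s \<le> arm_mean L a"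
begin

abbreviation "gap \<equiv> arm_gap K L"
abbreviation "\<epsilon> \<equiv> eff_range K L"
abbreviation "bad_arms \<equiv> {a\<in>{..<K}. gap a > 0}"

text \<open>Almost sure bound on a loss-difference estimate: importance factor times effective
  range.\<close>

definition "R = (real K - 1) * \<epsilon>"

lemma K1: "real K - 1 \<ge> 1" using K2 by simp

section \<open>Integrability of the losses, gaps and the effective range\<close>

lemma measurable_component [measurable]: "a < K \<Longrightarrow> (\<lambda>l. l a) \<in> borel_measurable L"
  by (subst measurable_cong_sets[OF sets_L refl]) (rule measurable_component_singleton, simp)

lemma integrable_loss: "a < K \<Longrightarrow> integrable L (\<lambda>l. l a)"
  using loss01 by (intro integrable_const_bound[where B = 1]) (auto elim!: eventually_mono)

lemma gap_eq: "gap a = arm_mean L a - arm_mean L s"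
proof -
  have "(MIN b\<in>{..<K}. arm_mean L b) = arm_mean L s"
    using s_less s_best by (intro Min_eqI) auto
  then show ?thesis by (simp add: arm_gap_def)
qed

text \<open>The infimum is attained: the bounds \<open>\<epsilon> + 1 / real (Suc n)\<close> are
  countably many, so they hold simultaneously almost everywhere, and \<open>n\<close> tends to
  infinity.\<close>

lemma AE_eff_range: "AE l in L. \<forall>a<K. \<forall>b<K. \<bar>l a - l b\<bar> \<le> \<epsilon>"
proof -
  let ?E = "{e. AE l in L. \<forall>a<K. \<forall>b<K. \<bar>l a - l b\<bar> \<le> e}"
  \<comment> \<open>Losses lie in the unit interval, so the infimum is over a nonempty set.\<close>
  have ne: "1 \<in> ?E"
    using loss01 by (auto elim!: eventually_mono) (smt (verit))
  have "AE l in L. \<forall>a<K. \<forall>b<K. \<bar>l a - l b\<bar> \<le> \<epsilon> + 1 / real (Suc n)" for n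
  proof -
    have "\<epsilon> < \<epsilon> + 1 / real (Suc n)" by simp
    then obtain e where e: "e \<in> ?E" "e < \<epsilon> + 1 / real (Suc n)"
      using cInf_lessD[of ?E] ne unfolding eff_range_def by blast
    from e(1) have "AE l in L. \<forall>a<K. \<forall>b<K. \<bar>l a - l b\<bar> \<le> e" by simp
    then show ?thesis
      by (rule eventually_mono) (use e(2) in fastforce)
  qed
  then have "AE l in L. \<forall>n. \<forall>a<K. \<forall>b<K. \<bar>l a - l b\<bar> \<le> \<epsilon> + 1 / real (Suc n)"
    by (simp add: AE_all_countable)
  then show ?thesis
  proof (rule eventually_mono, intro allI impI)
    fix l :: "nat \<Rightarrow> real" and a b
    assume *: "\<forall>n. \<forall>a<K. \<forall>b<K. \<bar>l a - l b\<bar> \<le> \<epsilon> + 1 / real (Suc n)" "a < K" "b < K"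
    show "\<bar>l a - l b\<bar> \<le> \<epsilon>"
    proof (rule field_le_epsilon)
      fix e :: real assume "0 < e"
      then obtain n where "1 / real (Suc n) < e"
        using nat_approx_posE by blast
      then show "\<bar>l a - l b\<bar> \<le> \<epsilon> + e" using * by (meson add_left_mono less_imp_le order_trans)
    qed
  qed
qed

lemma eff_range_nonneg: "0 \<le> \<epsilon>"
proof -
  have "AE l in L. 0 \<le> \<epsilon>"
    using AE_eff_range by (rule eventually_mono) (use s_less in force)
  then show ?thesis by simp
qed

lemma gap_le_eff_range:
  assumes "a < K" shows "gap a \<le> \<epsilon>"
proof -
  have "gap a = (\<integral>l. l a - l s \<partial>L)"
    using assms s_less by (simp add: gap_eq arm_mean_def integrable_loss)
  also have "\<dots> \<le> (\<integral>l. \<epsilon> \<partial>L)"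
    using assms s_less AE_eff_range
    by (intro integral_mono_AE) (auto simp: integrable_loss abs_le_iff elim!: eventually_mono)
  finally show ?thesis by (simp add: prob_space)
qed

lemma R_nonneg: "0 \<le> R"
  using K1 eff_range_nonneg by (simp add: R_def)

lemma gap_le_R: "a < K \<Longrightarrow> gap a \<le> R"
  using gap_le_eff_range[of a] mult_right_mono[OF K1 eff_range_nonneg] by (simp add: R_def)

lemma sum_secondary_weights:
  assumes "i < K"
  shows "(\<Sum>j\<in>{..<K} - {i}. 1 / (real K - 1)) = 1"
  using assms K2 by (simp add: of_nat_diff)

lemma soda_p_nonneg: "0 \<le> soda_p K st i"
  by (simp add: soda_p_def sum_nonneg)

lemma sum_soda_p: "(\<Sum>i<K. soda_p K st i) = 1"
proof -
  have "(\<Sum>b<K. exp (- soda_eta K st * fst st b - (soda_eta K st)\<^sup>2 * snd st b)) > 0"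
    using s_less by (intro sum_pos) auto
  then show ?thesis unfolding soda_p_def sum_divide_distrib[symmetric] by simp
qed

section \<open>Size, mean and exponential moments of the estimates\<close>

lemma AE_est_square_le:
  assumes "i < K" "j < K"
  shows "AE l in L. \<forall>a. (soda_est K i j l a)\<^sup>2 \<le> R\<^sup>2"
  using AE_eff_range
proof (rule eventually_mono, intro allI)
  fix l :: "nat \<Rightarrow> real" and a
  assume "\<forall>a<K. \<forall>b<K. \<bar>l a - l b\<bar> \<le> \<epsilon>"
  then have "\<bar>soda_est K i j l a\<bar> \<le> R"
    using assms K1 R_nonneg eff_range_nonneg by (auto simp: soda_est_def R_def abs_mult intro!: mult_left_mono)
  then show "(soda_est K i j l a)\<^sup>2 \<le> R\<^sup>2"
    by (rule abs_le_square_iff[THEN iffD1, OF order_trans]) simp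
qed

text \<open>One-round increment of the process \<open>X\<close> of the overview.\<close>

definition "est_diff i j l a = soda_est K i j l a - soda_est K i j l s"

text \<open>Only the secondary arm has a nonzero estimate, so for \<open>a \<noteq> s\<close> at
  most one of the two terms survives; hence \<open>R\<close> and not \<open>2 * R\<close>.\<close>

lemma AE_est_diff_le:
  assumes "i < K" "j < K"
  shows "AE l in L. \<forall>a. \<bar>est_diff i j l a\<bar> \<le> R"
  using AE_eff_range
  by (rule eventually_mono)
    (use assms K1 R_nonneg eff_range_nonneg in
      \<open>auto simp: est_diff_def soda_est_def R_def abs_mult intro!: mult_left_mono\<close>)

lemma est_diff_measurable [measurable]:
  "i < K \<Longrightarrow> j < K \<Longrightarrow> (\<lambda>l. est_diff i j l a) \<in> borel_measurable L"
  unfolding est_diff_def soda_est_def by measurable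

lemma integrable_est_diff:
  "i < K \<Longrightarrow> j < K \<Longrightarrow> integrable L (\<lambda>l. est_diff i j l a)"
  using AE_est_diff_le[of i j]
  by (intro integrable_const_bound[where B = R]) (auto elim!: eventually_mono)

text \<open>The probability \<open>1 / (real K - 1)\<close> of a secondary arm cancels the
  importance factor, and the mean of the primary arm \<open>i\<close> cancels in the difference. The
  drift is therefore the same for every \<open>i\<close>.\<close>

lemma mean_est_diff:
  assumes "i < K" "a < K"
  shows "(\<Sum>j\<in>{..<K} - {i}. 1 / (real K - 1) * (\<integral>l. est_diff i j l a \<partial>L)) = gap a"
proof -
  have mean: "(\<Sum>j\<in>{..<K} - {i}. 1 / (real K - 1) * (\<integral>l. soda_est K i j l b \<partial>L))
      = arm_mean L b - arm_mean L i" if "b < K" for b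
  proof -
    have "(\<Sum>j\<in>{..<K} - {i}. 1 / (real K - 1) * (\<integral>l. soda_est K i j l b \<partial>L))
        = (\<Sum>j\<in>{..<K} - {i}. if j = b then arm_mean L j - arm_mean L i else 0)"
      using assms K1
      by (intro sum.cong) (auto simp: soda_est_def arm_mean_def integrable_loss)
    then show ?thesis using that by (auto simp: sum.delta)
  qed
  have int: "integrable L (\<lambda>l. soda_est K i j l b)" if "j < K" for j b
    unfolding soda_est_def using that assms by (auto intro!: integrable_mult_right integrable_loss)
  have "(\<Sum>j\<in>{..<K} - {i}. 1 / (real K - 1) * (\<integral>l. est_diff i j l a \<partial>L))
      = (\<Sum>j\<in>{..<K} - {i}. 1 / (real K - 1) * (\<integral>l. soda_est K i j l a \<partial>L)
          - 1 / (real K - 1) * (\<integral>l. soda_est K i j l s \<partial>L))"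
    by (intro sum.cong refl) (simp add: est_diff_def int diff_divide_distrib)
  also have "\<dots> = gap a"
    unfolding sum_subtractf by (simp only: mean assms s_less gap_eq)
  finally show ?thesis .
qed

lemma integrable_exp_est_diff:
  assumes "i < K" "j < K" "c \<ge> 0"
  shows "integrable L (\<lambda>l. exp (- c * est_diff i j l a))"
proof (rule integrable_const_bound[where B = "exp (c * R)"])
  show "AE l in L. norm (exp (- c * est_diff i j l a)) \<le> exp (c * R)"
    using AE_est_diff_le[OF assms(1,2)]
  proof (rule eventually_mono)
    fix l assume "\<forall>a. \<bar>est_diff i j l a\<bar> \<le> R"
    then have "- est_diff i j l a \<le> R" by (smt (verit))
    from mult_left_mono[OF this assms(3)]
    show "norm (exp (- c * est_diff i j l a)) \<le> exp (c * R)" by simp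
  qed
qed (use assms in measurable)

text \<open>Bound the exponential by its quadratic majorant with square at most
  \<open>(c * R)\<^sup>2\<close>, average the linear term by \<open>mean_est_diff\<close>, and close
  with \<open>1 + x \<le> exp x\<close>.\<close>

lemma mgf_est_diff_le:
  assumes "i < K" "a < K" "c \<ge> 0" "c * R \<le> 1"
  shows "(\<Sum>j\<in>{..<K} - {i}. 1 / (real K - 1) * (\<integral>l. exp (- c * est_diff i j l a) \<partial>L))
    \<le> exp (- c * gap a + (c * R)\<^sup>2)"
proof -
  have "(\<integral>l. exp (- c * est_diff i j l a) \<partial>L) \<le> 1 + (c * R)\<^sup>2 - c * (\<integral>l. est_diff i j l a \<partial>L)"
    if j: "j < K" for j
  proof -
    have "(\<integral>l. exp (- c * est_diff i j l a) \<partial>L) \<le> (\<integral>l. 1 + (c * R)\<^sup>2 - c * est_diff i j l a \<partial>L)"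
    proof (rule integral_mono_AE)
      show "AE l in L. exp (- c * est_diff i j l a) \<le> 1 + (c * R)\<^sup>2 - c * est_diff i j l a"
        using AE_est_diff_le[OF assms(1) j]
      proof (rule eventually_mono)
        fix l assume "\<forall>a. \<bar>est_diff i j l a\<bar> \<le> R"
        then have le: "\<bar>- c * est_diff i j l a\<bar> \<le> c * R"
          using assms(3) by (simp add: abs_mult mult_left_mono)
        then have "(- c * est_diff i j l a)\<^sup>2 \<le> (c * R)\<^sup>2"
          by (rule abs_le_square_iff[THEN iffD1, OF order_trans]) simp
        moreover have "exp (- c * est_diff i j l a)
            \<le> 1 + (- c * est_diff i j l a) + (- c * est_diff i j l a)\<^sup>2"
          using le assms(4) by (intro exp_le_quadratic) simp
        ultimately show "exp (- c * est_diff i j l a) \<le> 1 + (c * R)\<^sup>2 - c * est_diff i j l a"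
          by simp
      qed
    qed (use assms j in \<open>auto simp: integrable_exp_est_diff[simplified] integrable_est_diff\<close>)
    also have "\<dots> = 1 + (c * R)\<^sup>2 - c * (\<integral>l. est_diff i j l a \<partial>L)"
      using assms j by (simp add: integrable_est_diff prob_space)
    finally show ?thesis .
  qed
  then have "(\<Sum>j\<in>{..<K} - {i}. 1 / (real K - 1) * (\<integral>l. exp (- c * est_diff i j l a) \<partial>L))
    \<le> (\<Sum>j\<in>{..<K} - {i}. 1 / (real K - 1) * (1 + (c * R)\<^sup>2 - c * (\<integral>l. est_diff i j l a \<partial>L)))"
    using K1 by (intro sum_mono mult_left_mono) auto
  also have "\<dots> = (1 + (c * R)\<^sup>2) * (\<Sum>j\<in>{..<K} - {i}. 1 / (real K - 1))
      - c * (\<Sum>j\<in>{..<K} - {i}. 1 / (real K - 1) * (\<integral>l. est_diff i j l a \<partial>L))"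
    unfolding sum_distrib_left sum_subtractf[symmetric]
    by (intro sum.cong refl) (simp only: right_diff_distrib mult_ac mult_1_right)
  also have "\<dots> = 1 + (- c * gap a + (c * R)\<^sup>2)"
    by (simp only: sum_secondary_weights mean_est_diff assms) simp
  also have "\<dots> \<le> exp (- c * gap a + (c * R)\<^sup>2)"
    by (rule exp_ge_add_one_self)
  finally show ?thesis .
qed

section \<open>States after \<open>m\<close> rounds and the expected loss across one round\<close>

definition reachable :: "nat \<Rightarrow> soda_state \<Rightarrow> bool" where
  "reachable m st \<longleftrightarrow> (\<forall>a<K. 0 \<le> snd st a \<and> snd st a \<le> real m * R\<^sup>2)"

lemma Max_snd_nonneg:
  assumes "reachable m st"
  shows "0 \<le> Max (snd st ` {..<K})"
  using assms s_less by (auto simp: reachable_def Max_ge_iff lessThan_empty_iff intro!: bexI[of _ s])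

text \<open>The process \<open>X\<close> of the overview, read off the state.\<close>

definition lead :: "soda_state \<Rightarrow> nat \<Rightarrow> real" where
  "lead st a = fst st a - fst st s"

lemma lead_upd: "lead (soda_upd K st i j l) a = lead st a + est_diff i j l a"
  by (simp add: lead_def soda_upd_def est_diff_def)

lemma AE_reachable_upd:
  assumes "reachable m st" "i < K" "j < K"
  shows "AE l in L. reachable (Suc m) (soda_upd K st i j l)"
  using AE_est_square_le[OF assms(2,3)]
proof (rule eventually_mono)
  fix l assume "\<forall>a. (soda_est K i j l a)\<^sup>2 \<le> R\<^sup>2"
  with assms(1) show "reachable (Suc m) (soda_upd K st i j l)"
    unfolding reachable_def soda_upd_def
    by (auto simp: distrib_right) (metis add.commute add_mono)
qed

text \<open>One-round regret decomposition: the probabilities sum to 1 and arms outside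
  \<open>bad_arms\<close> have gap 0.\<close>

lemma sum_soda_p_mean:
  "(\<Sum>i<K. soda_p K st i * arm_mean L i)
    = arm_mean L s + (\<Sum>a\<in>bad_arms. gap a * soda_p K st a)"
proof -
  have "(\<Sum>i<K. soda_p K st i * arm_mean L i)
      = arm_mean L s * (\<Sum>i<K. soda_p K st i) + (\<Sum>a<K. gap a * soda_p K st a)"
    unfolding sum_distrib_left sum.distrib[symmetric]
    by (intro sum.cong refl) (simp add: gap_eq algebra_simps)
  also have "(\<Sum>a<K. gap a * soda_p K st a) = (\<Sum>a\<in>bad_arms. gap a * soda_p K st a)"
    using s_best by (intro sum.mono_neutral_right) (force simp: gap_eq)+
  finally show ?thesis by (simp add: sum_soda_p)
qed

text \<open>Nothing is known about measurability of the value function in the sampled loss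
  vector, but since the bound is nonnegative and integrable, comparing Bochner integrals does not
  need it: a non-integrable function has integral 0.\<close>

lemma soda_loss_Suc_le:
  assumes IH: "\<And>st. reachable (Suc m) st \<Longrightarrow>
      soda_loss K L n st \<le> C + (\<Sum>a\<in>bad_arms. w a * exp (- c a * lead st a))"
    and st: "reachable m st"
    and C: "C \<ge> 0" and w: "\<And>a. a \<in> bad_arms \<Longrightarrow> w a \<ge> 0"
    and c: "\<And>a. a \<in> bad_arms \<Longrightarrow> c a \<ge> 0 \<and> c a * R \<le> 1"
  shows "soda_loss K L (Suc n) st \<le> C + arm_mean L s
    + (\<Sum>a\<in>bad_arms. gap a * soda_p K st a)
    + (\<Sum>a\<in>bad_arms. w a * exp (- c a * gap a + (c a * R)\<^sup>2) * exp (- c a * lead st a))"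
proof -
  \<comment> \<open>As \<open>lead\<close> is additive under an update, the exponential factors;
    \<open>v\<close> collects the part fixed before the round.\<close>
  define v where "v a = w a * exp (- c a * lead st a)" for a
  have v: "a \<in> bad_arms \<Longrightarrow> v a \<ge> 0" for a using w by (simp add: v_def)
  have int: "integrable L (\<lambda>l. exp (- c a * est_diff i j l a))"
    if "a \<in> bad_arms" "i < K" "j < K" for a i j
    using that c by (intro integrable_exp_est_diff) auto
  have step: "(\<integral>l. l i + soda_loss K L n (soda_upd K st i j l) \<partial>L)
      \<le> (arm_mean L i + C) + (\<Sum>a\<in>bad_arms. v a * (\<integral>l. exp (- c a * est_diff i j l a) \<partial>L))"
    if i: "i < K" and j: "j < K" for i j
  proof -
    have "(\<integral>l. l i + soda_loss K L n (soda_upd K st i j l) \<partial>L)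
        \<le> (\<integral>l. (l i + C) + (\<Sum>a\<in>bad_arms. v a * exp (- c a * est_diff i j l a)) \<partial>L)"
    proof (rule integral_mono_AE')
      show "integrable L (\<lambda>l. (l i + C) + (\<Sum>a\<in>bad_arms. v a * exp (- c a * est_diff i j l a)))"
        using int i j by (intro Bochner_Integration.integrable_add integrable_loss
            Bochner_Integration.integrable_sum integrable_mult_right) auto
      show "AE l in L. l i + soda_loss K L n (soda_upd K st i j l)
          \<le> (l i + C) + (\<Sum>a\<in>bad_arms. v a * exp (- c a * est_diff i j l a))"
        using AE_reachable_upd[OF st i j]
      proof (rule eventually_mono)
        fix l assume "reachable (Suc m) (soda_upd K st i j l)"
        from IH[OF this]
        show "l i + soda_loss K L n (soda_upd K st i j l)
            \<le> (l i + C) + (\<Sum>a\<in>bad_arms. v a * exp (- c a * est_diff i j l a))"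
          by (simp add: lead_upd v_def mult.assoc exp_add[symmetric] algebra_simps)
      qed
      show "AE l in L. 0 \<le> (l i + C) + (\<Sum>a\<in>bad_arms. v a * exp (- c a * est_diff i j l a))"
        using loss01
      proof (rule eventually_mono)
        fix l :: "nat \<Rightarrow> real" assume "\<forall>a<K. 0 \<le> l a \<and> l a \<le> 1"
        then have "0 \<le> l i" using i by simp
        moreover have "0 \<le> (\<Sum>a\<in>bad_arms. v a * exp (- c a * est_diff i j l a))"
          using v by (intro sum_nonneg mult_nonneg_nonneg) auto
        ultimately show "0 \<le> (l i + C) + (\<Sum>a\<in>bad_arms. v a * exp (- c a * est_diff i j l a))"
          using C by linarith
      qed
    qed
    also have "\<dots> = (\<integral>l. l i + C \<partial>L)
        + (\<integral>l. (\<Sum>a\<in>bad_arms. v a * exp (- c a * est_diff i j l a)) \<partial>L)"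
      using int i j by (intro Bochner_Integration.integral_add Bochner_Integration.integrable_add
          integrable_loss Bochner_Integration.integrable_sum integrable_mult_right) auto
    also have "(\<integral>l. l i + C \<partial>L) = arm_mean L i + C"
      using i by (simp add: integrable_loss arm_mean_def prob_space)
    also have "(\<integral>l. (\<Sum>a\<in>bad_arms. v a * exp (- c a * est_diff i j l a)) \<partial>L)
        = (\<Sum>a\<in>bad_arms. v a * (\<integral>l. exp (- c a * est_diff i j l a) \<partial>L))"
      using int i j by (subst Bochner_Integration.integral_sum) auto
    finally show ?thesis .
  qed
  let ?B = "\<Sum>a\<in>bad_arms. v a * exp (- c a * gap a + (c a * R)\<^sup>2)"
  \<comment> \<open>The moment bound is uniform in the primary arm, so \<open>i\<close> enters only
    through \<open>arm_mean L i\<close> and averaging over \<open>soda_p\<close> leaves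
    \<open>C + ?B\<close> unchanged.\<close>
  have inner: "(\<Sum>j\<in>{..<K} - {i}. (1 / (real K - 1)) *
      (\<integral>l. l i + soda_loss K L n (soda_upd K st i j l) \<partial>L)) \<le> arm_mean L i + C + ?B"
    if i: "i < K" for i
  proof -
    have "(\<Sum>j\<in>{..<K} - {i}. (1 / (real K - 1)) *
        (\<integral>l. l i + soda_loss K L n (soda_upd K st i j l) \<partial>L))
      \<le> (\<Sum>j\<in>{..<K} - {i}. (1 / (real K - 1)) * ((arm_mean L i + C)
          + (\<Sum>a\<in>bad_arms. v a * (\<integral>l. exp (- c a * est_diff i j l a) \<partial>L))))"
      using K1 i by (intro sum_mono mult_left_mono step) auto
    also have "\<dots> = (arm_mean L i + C) * (\<Sum>j\<in>{..<K} - {i}. 1 / (real K - 1))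
        + (\<Sum>j\<in>{..<K} - {i}. \<Sum>a\<in>bad_arms.
            v a * (1 / (real K - 1) * (\<integral>l. exp (- c a * est_diff i j l a) \<partial>L)))"
      unfolding distrib_left distrib_right sum.distrib sum_distrib_left
      by (intro arg_cong2[where f = "(+)"] sum.cong refl) (simp_all only: mult_ac mult_1_right)
    also have "\<dots> = arm_mean L i + C + (\<Sum>a\<in>bad_arms. v a *
        (\<Sum>j\<in>{..<K} - {i}. 1 / (real K - 1) * (\<integral>l. exp (- c a * est_diff i j l a) \<partial>L)))"
      by (subst sum.swap) (simp only: sum_secondary_weights[OF i] sum_distrib_left mult_1_right)
    also have "\<dots> \<le> arm_mean L i + C + ?B"
      using v i c by (intro add_left_mono sum_mono mult_left_mono mgf_est_diff_le) auto
    finally show ?thesis .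
  qed
  have "soda_loss K L (Suc n) st \<le> (\<Sum>i<K. soda_p K st i * (arm_mean L i + C + ?B))"
    unfolding soda_loss.simps by (intro sum_mono mult_left_mono inner soda_p_nonneg) auto
  also have "\<dots> = (\<Sum>i<K. soda_p K st i * arm_mean L i) + (C + ?B) * (\<Sum>i<K. soda_p K st i)"
    unfolding sum_distrib_left sum.distrib[symmetric]
    by (intro sum.cong refl) (simp add: algebra_simps)
  also have "\<dots> = C + arm_mean L s + (\<Sum>a\<in>bad_arms. gap a * soda_p K st a) + ?B"
    unfolding sum_soda_p sum_soda_p_mean by simp
  also have "?B = (\<Sum>a\<in>bad_arms. w a * exp (- c a * gap a + (c a * R)\<^sup>2) * exp (- c a * lead st a))"
    by (intro sum.cong refl) (simp add: v_def)
  finally show ?thesis .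
qed

section \<open>The regret bound\<close>

text \<open>\<open>tilt\<close> is the Chernoff parameter \<open>\<lambda>\<close>. The second term of \<open>tail\<close>
  accounts for the rounds in which the learning rate is at its cap, the first for the others, where
  \<open>rate a\<close> times \<open>sqrt m\<close> is a lower bound for \<open>\<eta> m \<Delta> / 2\<close>.\<close>

definition "tilt a = gap a / (4 * R\<^sup>2)"
definition "rate a = sqrt (ln (real K) / 2) * gap a / (2 * R)"
definition "tail a m = real K * exp (- rate a * sqrt (real m))
  + real K * exp (- (gap a / (4 * (real K - 1))) * real m)"

section \<open>Probability of playing a suboptimal arm\<close>

lemma bad_arm_pos:
  assumes "a \<in> bad_arms"
  shows "0 < gap a" "0 < R" "0 < \<epsilon>" "0 < tilt a" "0 < rate a"
proof -
  show "0 < gap a" using assms by simp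
  moreover show R: "0 < R" using assms gap_le_R[of a] by auto
  moreover show "0 < \<epsilon>" using R K1 by (simp add: R_def zero_less_mult_iff)
  ultimately show "0 < tilt a" "0 < rate a" using K2 by (auto simp: tilt_def rate_def)
qed

text \<open>Since \<open>gap a \<le> R\<close>, the product is even at most 1/4. This admits
  \<open>tilt a\<close> as parameter in \<open>mgf_est_diff_le\<close>.\<close>

lemma tilt_mult_R_le:
  assumes "a \<in> bad_arms"
  shows "tilt a * R \<le> 1"
  using bad_arm_pos[OF assms] gap_le_R[of a] assms
  by (simp add: tilt_def power2_eq_square field_simps)

text \<open>Keep only the summand of \<open>s\<close> in the normaliser. The correction of
  \<open>a\<close> has the favourable sign and is dropped; that of \<open>s\<close> is at most
  \<open>ln (real K)\<close>, which is the factor \<open>real K\<close>.\<close>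

lemma soda_p_le:
  assumes st: "reachable m st" and a: "a < K"
  shows "soda_p K st a \<le> real K * exp (- soda_eta K st * lead st a)"
proof -
  let ?\<eta> = "soda_eta K st" and ?M = "Max (snd st ` {..<K})"
  let ?u = "\<lambda>b. exp (- ?\<eta> * fst st b - ?\<eta>\<^sup>2 * snd st b)"
  have S: "0 \<le> snd st a" "0 \<le> snd st s" "snd st s \<le> ?M"
    using st a s_less by (auto simp: reachable_def)
  have \<eta>: "0 \<le> ?\<eta>" "?\<eta> \<le> sqrt (ln (real K) / (?M + (real K - 1)\<^sup>2))"
    using K2 S by (auto simp: soda_eta_def)
  have pos: "0 < ?M + (real K - 1)\<^sup>2" using S K1 by (intro add_nonneg_pos) auto
  have "?\<eta>\<^sup>2 \<le> ln (real K) / (?M + (real K - 1)\<^sup>2)"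
    using power_mono[OF \<eta>(2,1), of 2] pos K2 by simp
  then have "?\<eta>\<^sup>2 * (?M + (real K - 1)\<^sup>2) \<le> ln (real K)"
    using pos by (simp add: le_divide_eq)
  moreover have "?\<eta>\<^sup>2 * snd st s \<le> ?\<eta>\<^sup>2 * (?M + (real K - 1)\<^sup>2)"
    using S by (intro mult_left_mono) (auto intro: add_increasing2)
  ultimately have \<eta>S: "?\<eta>\<^sup>2 * snd st s \<le> ln (real K)" by linarith
  have "soda_p K st a \<le> ?u a / ?u s"
    unfolding soda_p_def using s_less by (intro divide_left_mono member_le_sum mult_pos_pos sum_pos) auto
  also have "\<dots> = exp (- ?\<eta> * lead st a + (?\<eta>\<^sup>2 * snd st s - ?\<eta>\<^sup>2 * snd st a))"
    by (simp add: exp_diff[symmetric] lead_def algebra_simps)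
  also have "\<dots> \<le> exp (- ?\<eta> * lead st a + ln (real K))"
    using \<eta>S S by (simp add: add_increasing2 diff_le_eq)
  also have "\<dots> = real K * exp (- ?\<eta> * lead st a)"
    unfolding exp_add using K2 by simp
  finally show ?thesis .
qed

lemma soda_p_le_1: "a < K \<Longrightarrow> soda_p K st a \<le> 1"
  using member_le_sum[of a "{..<K}" "soda_p K st"] by (simp add: sum_soda_p soda_p_nonneg)

lemma eta_ge:
  assumes st: "reachable m st" and a: "a \<in> bad_arms"
  shows "rate a * sqrt (real m) \<le> soda_eta K st * (real m * gap a / 2)
    \<or> gap a / (4 * (real K - 1)) * real m \<le> soda_eta K st * (real m * gap a / 2)"
proof -
  let ?\<eta> = "soda_eta K st" and ?M = "Max (snd st ` {..<K})"
  note pos = bad_arm_pos[OF a]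
  have M0: "0 \<le> ?M" by (rule Max_snd_nonneg[OF st])
  have M: "?M \<le> real m * R\<^sup>2"
    using st s_less by (auto simp: reachable_def lessThan_empty_iff)
  have den: "0 < ?M + (real K - 1)\<^sup>2" using M0 K1 by (intro add_nonneg_pos) auto
  have lnK: "1 / 2 \<le> ln (real K)"
    using ln2_ge_two_thirds ln_le_cancel_iff[of 2 "real K"] K2 by linarith
  have second: ?thesis if "1 / (2 * (real K - 1)) \<le> ?\<eta>"
    using mult_right_mono[OF that, of "real m * gap a / 2"] pos by (simp add: mult_ac)
  \<comment> \<open>The threshold compares \<open>real m * R\<^sup>2\<close> with
    \<open>(real K - 1)\<^sup>2\<close>. Below it the denominator is at most
    \<open>2 * (real K - 1)\<^sup>2\<close>, and \<open>ln (real K) \<ge> 1 / 2\<close> puts the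
    learning rate at its cap; above it the denominator is at most
    \<open>2 * (real m * R\<^sup>2)\<close>.\<close>
  consider "real m * \<epsilon>\<^sup>2 \<le> 1" | "real m * \<epsilon>\<^sup>2 > 1" by linarith
  then show ?thesis
  proof cases
    case 1
    have "?M + (real K - 1)\<^sup>2 \<le> 2 * (real K - 1)\<^sup>2"
      using M mult_right_mono[OF 1, of "(real K - 1)\<^sup>2"] by (simp add: R_def power_mult_distrib mult_ac)
    then have "(1 / 2) / (2 * (real K - 1)\<^sup>2) \<le> ln (real K) / (?M + (real K - 1)\<^sup>2)"
      using den lnK by (intro frac_le) auto
    then have "(1 / (2 * (real K - 1)))\<^sup>2 \<le> ln (real K) / (?M + (real K - 1)\<^sup>2)"
      unfolding power_divide power_mult_distrib by simp
    then have "1 / (2 * (real K - 1)) \<le> ?\<eta>"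
      unfolding soda_eta_def using real_le_rsqrt by auto
    then show ?thesis by (rule second)
  next
    case 2
    show ?thesis
    proof (cases "1 / (2 * (real K - 1)) \<le> ?\<eta>")
      case False
      have m: "real m > 0" using 2 by (cases m) auto
      have "(real K - 1)\<^sup>2 \<le> real m * R\<^sup>2"
        using mult_right_mono[OF less_imp_le[OF 2], of "(real K - 1)\<^sup>2"]
        by (simp add: R_def power_mult_distrib mult_ac)
      then have "ln (real K) / (2 * (real m * R\<^sup>2)) \<le> ln (real K) / (?M + (real K - 1)\<^sup>2)"
        using M den lnK by (intro divide_left_mono) auto
      then have "sqrt (ln (real K) / (2 * (real m * R\<^sup>2))) \<le> ?\<eta>"
        using False by (auto simp: soda_eta_def min_def split: if_splits)
      moreover have "sqrt (ln (real K) / (2 * (real m * R\<^sup>2)))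
          = sqrt (ln (real K) / 2) / (sqrt (real m) * R)"
        using pos by (simp add: real_sqrt_divide real_sqrt_mult)
      ultimately have "sqrt (ln (real K) / 2) / (sqrt (real m) * R) * (real m * gap a / 2)
          \<le> ?\<eta> * (real m * gap a / 2)"
        using pos by (intro mult_right_mono) auto
      moreover have "sqrt (ln (real K) / 2) / (sqrt (real m) * R) * (real m * gap a / 2)
          = rate a * (real m / sqrt (real m))"
        by (simp add: rate_def mult_ac)
      moreover have "real m / sqrt (real m) = sqrt (real m)"
        by (simp add: real_div_sqrt)
      ultimately show ?thesis by (intro disjI1) (simp only:)
    qed (rule second)
  qed
qed

text \<open>The two cases are merged into one sum: a multiple of
  \<open>exp (- tilt a * lead st a)\<close>, which \<open>mgf_est_diff_le\<close> can average over
  earlier rounds, and a deterministic term that joins the constant \<open>C\<close>.\<close>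

lemma soda_p_le_tail:
  assumes st: "reachable m st" and a: "a \<in> bad_arms"
  shows "soda_p K st a \<le> exp (tilt a * (real m * gap a / 2)) * exp (- tilt a * lead st a) + tail a m"
proof (cases "lead st a \<le> real m * gap a / 2")
  case True
  have "soda_p K st a \<le> 1" using a by (intro soda_p_le_1) auto
  also have "1 \<le> exp (tilt a * (real m * gap a / 2 - lead st a))"
    using True bad_arm_pos[OF a] by simp
  also have "\<dots> = exp (tilt a * (real m * gap a / 2)) * exp (- tilt a * lead st a)"
    by (simp add: exp_add[symmetric] algebra_simps)
  also have "\<dots> \<le> \<dots> + tail a m" by (simp add: tail_def)
  finally show ?thesis .
next
  case False
  let ?\<eta> = "soda_eta K st"
  have "0 \<le> ?\<eta>"
    using Max_snd_nonneg[OF st] K2 by (simp add: soda_eta_def)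
  then have "?\<eta> * (real m * gap a / 2) \<le> ?\<eta> * lead st a"
    using False by (intro mult_left_mono) auto
  with eta_ge[OF assms] have "exp (- ?\<eta> * lead st a) \<le> exp (- rate a * sqrt (real m))
    \<or> exp (- ?\<eta> * lead st a) \<le> exp (- (gap a / (4 * (real K - 1))) * real m)"
    by fastforce
  then have "exp (- ?\<eta> * lead st a) \<le> exp (- rate a * sqrt (real m))
      + exp (- (gap a / (4 * (real K - 1))) * real m)"
    by (smt (verit) exp_ge_zero)
  then have "real K * exp (- ?\<eta> * lead st a) \<le> tail a m"
    unfolding tail_def distrib_left[symmetric] by (intro mult_left_mono) auto
  moreover have "soda_p K st a \<le> real K * exp (- ?\<eta> * lead st a)"
    using a by (intro soda_p_le[OF st]) auto
  ultimately show ?thesis by (smt (verit) exp_ge_zero mult_nonneg_nonneg)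
qed

section \<open>Backward induction on the remaining rounds\<close>

lemma tail_nonneg: "0 \<le> tail a m" by (simp add: tail_def)

lemma mean_nonneg: "a < K \<Longrightarrow> 0 \<le> arm_mean L a"
  unfolding arm_mean_def using loss01 by (intro integral_nonneg_AE) (auto elim!: eventually_mono)

text \<open>Factor by which averaging over one round multiplies the bound on
  \<open>exp (- tilt a * lead st a)\<close>.\<close>

definition "decay a = exp (- tilt a * gap a + (tilt a * R)\<^sup>2)"

text \<open>Accumulated Chernoff coefficient of \<open>n\<close> remaining rounds after
  \<open>m\<close> past ones: the term of round \<open>m + k\<close> has been averaged over
  \<open>k\<close> rounds.\<close>

definition "weight a m n = (\<Sum>k<n. exp (tilt a * (real (m + k) * gap a / 2)) * decay a ^ k)"

lemma weight_nonneg: "0 \<le> weight a m n"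
  by (simp add: weight_def decay_def sum_nonneg)

lemma weight_Suc:
  "weight a m (Suc n) = exp (tilt a * (real m * gap a / 2)) + decay a * weight a (Suc m) n"
  by (simp add: weight_def sum.lessThan_Suc_shift sum_distrib_left algebra_simps del: sum.lessThan_Suc)

text \<open>The current \<open>soda_p\<close> is left unestimated because it is used in two ways:
  through \<open>soda_p_le_tail\<close> inside the induction, and with its exact value in the first
  round.\<close>

lemma soda_loss_Suc_le_weight:
  assumes IH: "\<And>st. reachable (Suc m) st \<Longrightarrow> soda_loss K L n st \<le> real n * arm_mean L s
      + (\<Sum>a\<in>bad_arms. gap a * (\<Sum>k<n. tail a (Suc m + k)))
      + (\<Sum>a\<in>bad_arms. gap a * weight a (Suc m) n * exp (- tilt a * lead st a))"
    and st: "reachable m st"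
  shows "soda_loss K L (Suc n) st \<le> real (Suc n) * arm_mean L s
      + (\<Sum>a\<in>bad_arms. gap a * (\<Sum>k<n. tail a (Suc m + k)))
      + (\<Sum>a\<in>bad_arms. gap a * soda_p K st a)
      + (\<Sum>a\<in>bad_arms. gap a * weight a (Suc m) n * decay a * exp (- tilt a * lead st a))"
proof -
  have C: "0 \<le> real n * arm_mean L s + (\<Sum>a\<in>bad_arms. gap a * (\<Sum>k<n. tail a (Suc m + k)))"
    using s_less by (intro add_nonneg_nonneg mult_nonneg_nonneg sum_nonneg tail_nonneg mean_nonneg) auto
  have w: "0 \<le> gap a * weight a (Suc m) n" if "a \<in> bad_arms" for a
    using that by (simp add: weight_nonneg)
  have c: "0 \<le> tilt a \<and> tilt a * R \<le> 1" if "a \<in> bad_arms" for a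
    using bad_arm_pos[OF that] tilt_mult_R_le[OF that] by auto
  show ?thesis
    using soda_loss_Suc_le[OF IH st C w c] by (simp add: decay_def algebra_simps)
qed

text \<open>\<open>m\<close> and \<open>st\<close> must be general, since a step passes to
  \<open>Suc m\<close> and a random successor state. The current round supplies the new leading
  terms of \<open>tail\<close> and \<open>weight\<close>.\<close>

lemma soda_loss_le:
  assumes "reachable m st"
  shows "soda_loss K L n st \<le> real n * arm_mean L s
      + (\<Sum>a\<in>bad_arms. gap a * (\<Sum>k<n. tail a (m + k)))
      + (\<Sum>a\<in>bad_arms. gap a * weight a m n * exp (- tilt a * lead st a))"
  using assms
proof (induction n arbitrary: m st)
  case 0
  then show ?case by (simp add: weight_def)
next
  case (Suc n)
  have "(\<Sum>a\<in>bad_arms. gap a * soda_p K st a) \<le> (\<Sum>a\<in>bad_arms. gap a *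
      (exp (tilt a * (real m * gap a / 2)) * exp (- tilt a * lead st a) + tail a m))"
    using soda_p_le_tail[OF Suc.prems] by (intro sum_mono mult_left_mono) auto
  with soda_loss_Suc_le_weight[OF Suc.IH Suc.prems]
  have "soda_loss K L (Suc n) st \<le> real (Suc n) * arm_mean L s
      + (\<Sum>a\<in>bad_arms. gap a * (\<Sum>k<n. tail a (Suc m + k)))
      + (\<Sum>a\<in>bad_arms. gap a *
      (exp (tilt a * (real m * gap a / 2)) * exp (- tilt a * lead st a) + tail a m))
      + (\<Sum>a\<in>bad_arms. gap a * weight a (Suc m) n * decay a * exp (- tilt a * lead st a))"
    by linarith
  also have "\<dots> = real (Suc n) * arm_mean L s
      + (\<Sum>a\<in>bad_arms. gap a * (\<Sum>k<Suc n. tail a (m + k)))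
      + (\<Sum>a\<in>bad_arms. gap a * weight a m (Suc n) * exp (- tilt a * lead st a))"
    by (simp add: weight_Suc sum.lessThan_Suc_shift distrib_left distrib_right sum.distrib mult_ac
        del: sum.lessThan_Suc)
  finally show ?case .
qed

section \<open>Evaluation of the series and the final constants\<close>

lemma sum_tail_le:
  assumes a: "a \<in> bad_arms"
  shows "gap a * (\<Sum>k<n. tail a (Suc k))
    \<le> 16 * real K ^ 3 / ln (real K) * \<epsilon>\<^sup>2 / gap a + 4 * real K ^ 2"
proof -
  note pos = bad_arm_pos[OF a]
  have lnK: "0 < ln (real K)" using K2 by simp
  have "(\<Sum>k<n. tail a (Suc k)) = real K * (\<Sum>k<n. exp (- rate a * sqrt (real (Suc k))))
      + real K * (\<Sum>k<n. exp (- (gap a / (4 * (real K - 1))) * real (Suc k)))"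
    by (simp only: tail_def sum.distrib sum_distrib_left)
  also have "\<dots> \<le> real K * (2 / (rate a)\<^sup>2) + real K * (1 / (gap a / (4 * (real K - 1))))"
    using pos K1 by (intro add_mono mult_left_mono sum_exp_sqrt_le sum_exp_le) auto
  also have "(rate a)\<^sup>2 = ln (real K) * (gap a)\<^sup>2 / (8 * R\<^sup>2)"
    using lnK by (simp add: rate_def power_divide power_mult_distrib)
  finally have "gap a * (\<Sum>k<n. tail a (Suc k))
      \<le> gap a * (real K * (2 / (ln (real K) * (gap a)\<^sup>2 / (8 * R\<^sup>2)))
        + real K * (1 / (gap a / (4 * (real K - 1)))))"
    using pos by (intro mult_left_mono) auto
  also have "\<dots> = 16 * (real K * (real K - 1)\<^sup>2) / ln (real K) * \<epsilon>\<^sup>2 / gap a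
      + 4 * (real K * (real K - 1))"
    using pos lnK by (simp add: R_def field_simps power2_eq_square)
  \<comment> \<open>Only here is \<open>real K - 1\<close> rounded up to
    \<open>real K\<close>.\<close>
  also have "\<dots> \<le> 16 * (real K * (real K)\<^sup>2) / ln (real K) * \<epsilon>\<^sup>2 / gap a + 4 * (real K * real K)"
    using pos lnK K1
    by (intro add_mono mult_left_mono divide_right_mono mult_right_mono power_mono) auto
  finally show ?thesis by (simp add: power3_eq_cube power2_eq_square mult_ac)
qed

lemma weight_decay_le:
  assumes a: "a \<in> bad_arms"
  shows "gap a * weight a (Suc 0) n * decay a \<le> 16 * real K ^ 2 * \<epsilon>\<^sup>2 / gap a"
proof -
  note pos = bad_arm_pos[OF a]
  define c where "c = (gap a)\<^sup>2 / (16 * R\<^sup>2)"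
  \<comment> \<open>\<open>tilt a\<close> minimises
    \<open>- x * gap a / 2 + x\<^sup>2 * R\<^sup>2\<close> over \<open>x\<close>, and
    \<open>- c\<close> is the minimum. The factor \<open>decay a\<close> of the first round makes
    the geometric series start at exponent 1.\<close>
  have e: "tilt a * (gap a / 2) + (- tilt a * gap a + (tilt a * R)\<^sup>2) = - c"
    using pos by (simp add: tilt_def c_def field_simps power2_eq_square)
  have "weight a (Suc 0) n * decay a = (\<Sum>k<n. exp (- c * real (Suc k)))"
    unfolding weight_def sum_distrib_right
  proof (intro sum.cong refl)
    fix k
    have "exp (tilt a * (real (Suc 0 + k) * gap a / 2)) * decay a ^ k * decay a
        = exp (tilt a * (gap a / 2)) ^ Suc k * decay a ^ Suc k"
      by (subst exp_of_nat_mult[symmetric]) (simp add: algebra_simps)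
    also have "\<dots> = exp (- c) ^ Suc k"
      unfolding decay_def power_mult_distrib[symmetric] exp_add[symmetric] e ..
    also have "\<dots> = exp (- c * real (Suc k))"
      by (subst exp_of_nat_mult[symmetric]) (simp add: mult.commute)
    finally show "exp (tilt a * (real (Suc 0 + k) * gap a / 2)) * decay a ^ k * decay a
        = exp (- c * real (Suc k))" .
  qed
  also have "\<dots> \<le> 1 / c"
    using pos by (intro sum_exp_le) (simp add: c_def)
  finally have "gap a * (weight a (Suc 0) n * decay a) \<le> gap a * (1 / c)"
    using pos by (intro mult_left_mono) auto
  also have "\<dots> = 16 * (real K - 1)\<^sup>2 * \<epsilon>\<^sup>2 / gap a"
    using pos by (simp add: c_def R_def field_simps power2_eq_square)
  also have "\<dots> \<le> 16 * (real K)\<^sup>2 * \<epsilon>\<^sup>2 / gap a"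
    using pos K1 by (intro divide_right_mono mult_right_mono mult_left_mono power_mono) auto
  finally show ?thesis by (simp add: mult_ac)
qed

lemma soda_regret_le:
  assumes "T \<ge> 1"
  shows "soda_regret K L T \<le> (\<Sum>a\<in>bad_arms.
    (16 * real K ^ 3 / ln (real K) + 16 * real K ^ 2) * \<epsilon>\<^sup>2 / gap a + 4 * real K ^ 2 + gap a / real K)"
proof -
  obtain n where T: "T = Suc n" using assms by (cases T) auto
  let ?st = "(\<lambda>_. 0, \<lambda>_. 0) :: soda_state"
  have st: "reachable 0 ?st" by (simp add: reachable_def)
  have min: "(MIN a\<in>{..<K}. real T * arm_mean L a) = real T * arm_mean L s"
    using s_less s_best by (intro Min_eqI) (auto intro: mult_left_mono)
  have p: "soda_p K ?st a = 1 / real K" for a by (simp add: soda_p_def)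
  \<comment> \<open>The first round is split off with the exact probability
    \<open>1 / real K\<close>, since \<open>tail a 0 = 2 * real K\<close> would be too large. All
    leads are 0 in the initial state, so the exponentials equal 1.\<close>
  have "soda_loss K L T ?st \<le> real T * arm_mean L s
      + (\<Sum>a\<in>bad_arms. gap a * (\<Sum>k<n. tail a (Suc k)))
      + (\<Sum>a\<in>bad_arms. gap a / real K)
      + (\<Sum>a\<in>bad_arms. gap a * weight a (Suc 0) n * decay a)"
    using soda_loss_Suc_le_weight[OF soda_loss_le st, of n] by (simp add: T p lead_def del: soda_loss.simps)
  then have "soda_regret K L T \<le> (\<Sum>a\<in>bad_arms. gap a * (\<Sum>k<n. tail a (Suc k))
      + gap a / real K + gap a * weight a (Suc 0) n * decay a)"
    unfolding soda_regret_def min sum.distrib by linarith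
  also have "\<dots> \<le> (\<Sum>a\<in>bad_arms.
    (16 * real K ^ 3 / ln (real K) + 16 * real K ^ 2) * \<epsilon>\<^sup>2 / gap a + 4 * real K ^ 2 + gap a / real K)"
  proof (rule sum_mono)
    fix a assume a: "a \<in> bad_arms"
    show "gap a * (\<Sum>k<n. tail a (Suc k)) + gap a / real K + gap a * weight a (Suc 0) n * decay a
      \<le> (16 * real K ^ 3 / ln (real K) + 16 * real K ^ 2) * \<epsilon>\<^sup>2 / gap a + 4 * real K ^ 2 + gap a / real K"
      using sum_tail_le[OF a, of n] weight_decay_le[OF a, of n]
      by (simp add: distrib_right add_divide_distrib)
  qed
  finally show ?thesis .
qed

end

theorem theorem3:
  fixes K T :: nat and L :: "(nat \<Rightarrow> real) measure"
  assumes "K \<ge> 2"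
    and "prob_space L"
    and "sets L = sets (\<Pi>\<^sub>M a\<in>{..<K}. borel)"
    and "AE l in L. \<forall>a<K. 0 \<le> l a \<and> l a \<le> 1"
    and "T \<ge> 1"
  shows "soda_regret K L T \<le>
    (\<Sum>a\<in>{a\<in>{..<K}. arm_gap K L a > 0}.
       (16 * real K ^ 3 / ln (real K) + 16 * real K ^ 2) * (eff_range K L)^2 / arm_gap K L a
       + 4 * real K ^ 2 + arm_gap K L a / real K)"
proof -
  have "Min (arm_mean L ` {..<K}) \<in> arm_mean L ` {..<K}"
    using assms(1) by (intro Min_in) (auto simp: lessThan_empty_iff)
  then obtain s where s: "s < K" "Min (arm_mean L ` {..<K}) = arm_mean L s" by auto
  have "arm_mean L s \<le> arm_mean L a" if "a < K" for a
    using that unfolding s(2)[symmetric] by simp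
  then interpret soda L K s
    using assms s(1) by (intro soda.intro soda_axioms.intro) auto
  show ?thesis using assms(5) by (rule soda_regret_le)
qed

end
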